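(* Assume that $(A,B)$ is stabilizable and $(A,Q)$ is observable, and let the gains $L_1,L_2$ be chosen such that the matrix $$\mathcal{A}=\begin{bmatrix}A+B_2K_2-L_1H_1 & -B_2K_2\\ -B_1K_1 & A+B_1K_1-L_2H_2\end{bmatrix}$$ is stable. Then the decentralized controllers $u_i^\star(k)=K_i\hat x_i(k)$, $i=1,2$, are asymptotically optimal: for any initial values $x(0),\hat x_1(0),\hat x_2(0)\in\mathbb{R}^n$ and any $\varepsilon>0$ there exists a sufficiently large integer $N$ such that $$\delta J(N,\infty)=J^\star(N,\infty)-J^*(N,\infty)<\varepsilon.$$
   Context: Let $A\in\mathbb{R}^{n\times n}$, $B_i\in\mathbb{R}^{n\times m_i}$, $H_i\in\mathbb{R}^{s_i\times n}$ ($i=1,2$) be constant real matrices, $B=[B_1\ \ B_2]$. The system is $$x(k+1)=Ax(k)+B_1u_1(k)+B_2u_2(k),\qquad y_i(k)=H_ix(k),\quad i=1,2,\quad k\ge0.$$ Let $Q\in\mathbb{R}^{n\times n}$ be symmetric positive semi-definite, $R_i\in\mathbb{R}^{m_i\times m_i}$ symmetric positive definite, $R=\mathrm{diag}(R_1,R_2)$. Let $P$ be the symmetric positive semi-definite solution of the algebraic Riccati equation $$P=A'PA+Q-A'PB(R+B'PB)^{-1}B'PA,$$ and let $K=-(R+B'PB)^{-1}B'PA$, $K_1=[I\ \ 0]K$ (the first $m_1$ rows of $K$), $K_2=[0\ \ I]K$ (the last $m_2$ rows of $K$). Here $'$ denotes transpose. A square matrix is stable if all its eigenvalues lie in the open unit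 disc. The system is driven by $u_i=u_i^\star$, $u_i^\star(k)=K_i\hat x_i(k)$, where the observers satisfy $$\hat x_1(k+1)=A\hat x_1(k)+B_1u_1^\star(k)+B_2K_2\hat x_1(k)+L_1[y_1(k)-H_1\hat x_1(k)],$$ $$\hat x_2(k+1)=A\hat x_2(k)+B_1K_1\hat x_2(k)+B_2u_2^\star(k)+L_2[y_2(k)-H_2\hat x_2(k)],$$ with gains $L_i\in\mathbb{R}^{n\times s_i}$. For an integer $s\ge 0$ the cost is $$J(s,\infty)=\sum_{k=s}^\infty[x'(k)Qx(k)+u_1'(k)R_1u_1(k)+u_2'(k)R_2u_2(k)].$$ $J^\star(s,\infty)$ is the value of $J(s,\infty)$ along the closed-loop trajectory of $x(k+1)=Ax(k)+B_1u_1^\star(k)+B_2u_2^\star(k)$ with $u_i^\star(k)=K_i\hat x_i(k)$, $i=1,2$, and $\hat x_1,\hat x_2$ generated by the two observer equations from the initial values $x(0),\hat x_1(0),\hat x_2(0)$; $J^*(s,\infty)$ is the minimum of $J(s,\infty)$ over all control sequences $(u_1(k),u_2(k))_{k\ge s}$ for the system started at time $s$ from the same state $x(s)$ (the optimal cost attained by full state feedback). *)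

theory Defs
  imports "HOL-Analysis.Analysis"
begin

section \<open>Block matrices, indexed by sum types\<close>

definition block_row :: "'a^'p^'n \<Rightarrow> 'a^'q^'n \<Rightarrow> 'a^('p::finite + 'q::finite)^'n" where
  "block_row M N = (\<chi> i j. case j of Inl p \<Rightarrow> M $ i $ p | Inr q \<Rightarrow> N $ i $ q)"

definition block_col :: "'a^'n^'p \<Rightarrow> 'a^'n^'q \<Rightarrow> 'a^'n^('p::finite + 'q::finite)" where
  "block_col M N = (\<chi> i. case i of Inl p \<Rightarrow> M $ p | Inr q \<Rightarrow> N $ q)"

definition block_mat ::
  "'a^'p^'m \<Rightarrow> 'a^'q^'m \<Rightarrow> 'a^'p^'n \<Rightarrow> 'a^'q^'n \<Rightarrow> 'a^('p::finite + 'q::finite)^('m::finite + 'n::finite)" where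
  "block_mat M11 M12 M21 M22 = block_col (block_row M11 M12) (block_row M21 M22)"

definition upper_rows :: "'a^'n^('p::finite + 'q::finite) \<Rightarrow> 'a^'n^'p" where
  "upper_rows M = (\<chi> i. M $ Inl i)"

definition lower_rows :: "'a^'n^('p::finite + 'q::finite) \<Rightarrow> 'a^'n^'q" where
  "lower_rows M = (\<chi> i. M $ Inr i)"

section \<open>Matrix properties\<close>

definition sym_pos_semidef :: "real^'n^'n \<Rightarrow> bool" where
  "sym_pos_semidef M \<longleftrightarrow> transpose M = M \<and> (\<forall>v. 0 \<le> v \<bullet> (M *v v))"

definition sym_pos_def :: "real^'n^'n \<Rightarrow> bool" where
  "sym_pos_def M \<longleftrightarrow> transpose M = M \<and> (\<forall>v. v \<noteq> 0 \<longrightarrow> 0 < v \<bullet> (M *v v))"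

text \<open>Eigenvalues of a real matrix are complex in general.\<close>

definition complex_matrix :: "real^'n^'m \<Rightarrow> complex^'n^'m" where
  "complex_matrix M = (\<chi> i j. complex_of_real (M $ i $ j))"

definition complex_eigenvalue :: "real^'n^'n \<Rightarrow> complex \<Rightarrow> bool" where
  "complex_eigenvalue M l \<longleftrightarrow> (\<exists>v. v \<noteq> 0 \<and> complex_matrix M *v v = l *s v)"

definition stable_matrix :: "real^'n^'n \<Rightarrow> bool" where
  "stable_matrix M \<longleftrightarrow> (\<forall>l. complex_eigenvalue M l \<longrightarrow> cmod l < 1)"

definition stabilizable :: "real^'n^'n \<Rightarrow> real^'m^'n \<Rightarrow> bool" where
  "stabilizable A B \<longleftrightarrow> (\<exists>F. stable_matrix (A + B ** F))"

text \<open>Finitely many outputs of \<open>x(k+1) = A x(k), y(k) = C x(k)\<close> determine the initial state.\<close>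

definition observable :: "real^'n^'n \<Rightarrow> real^'n^'s \<Rightarrow> bool" where
  "observable A C \<longleftrightarrow>
     (\<exists>N::nat. \<forall>a b. (\<forall>k\<le>N. C *v (((*v) A ^^ k) a) = C *v (((*v) A ^^ k) b)) \<longrightarrow> a = b)"

section \<open>Riccati equation and feedback gain\<close>

definition riccati_solution ::
  "real^'n^'n \<Rightarrow> real^'m^'n \<Rightarrow> real^'n^'n \<Rightarrow> real^'m^'m \<Rightarrow> real^'n^'n \<Rightarrow> bool" where
  "riccati_solution A B Q R P \<longleftrightarrow>
     P = transpose A ** P ** A + Q
         - transpose A ** P ** B ** matrix_inv (R + transpose B ** P ** B) ** transpose B ** P ** A"

definition riccati_gain ::
  "real^'n^'n \<Rightarrow> real^'m^'n \<Rightarrow> real^'m^'m \<Rightarrow> real^'n^'n \<Rightarrow> real^'n^'m" where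
  "riccati_gain A B R P =
     - (matrix_inv (R + transpose B ** P ** B) ** transpose B ** P ** A)"

section \<open>Cost\<close>

text \<open>
  The series has nonnegative terms but may diverge for an arbitrary control sequence, so costs
  are extended reals. A difference \<open>\<infinity> - \<infinity>\<close> is \<open>\<infinity>\<close> in type \<open>ereal\<close>, so a bound
  \<open>cost \<dots> - optimal_cost \<dots> < ereal e\<close> also says that the first cost is finite.
\<close>

definition cost ::
  "real^'n^'n \<Rightarrow> real^'m1^'m1 \<Rightarrow> real^'m2^'m2 \<Rightarrow> nat \<Rightarrow>
   (nat \<Rightarrow> real^'n) \<Rightarrow> (nat \<Rightarrow> real^'m1) \<Rightarrow> (nat \<Rightarrow> real^'m2) \<Rightarrow> ereal" where
  "cost Q R1 R2 s x u1 u2 =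
     (\<Sum>j. ereal (x (s + j) \<bullet> (Q *v x (s + j))
                 + u1 (s + j) \<bullet> (R1 *v u1 (s + j))
                 + u2 (s + j) \<bullet> (R2 *v u2 (s + j))))"

text \<open>
  Values of \<open>x\<close>, \<open>u1\<close>, \<open>u2\<close> before time \<open>s\<close> are irrelevant. The minimum over all
  control sequences is expressed as the infimum of the attainable costs.
\<close>

definition optimal_cost ::
  "real^'n^'n \<Rightarrow> real^'m1^'n \<Rightarrow> real^'m2^'n \<Rightarrow>
   real^'n^'n \<Rightarrow> real^'m1^'m1 \<Rightarrow> real^'m2^'m2 \<Rightarrow> nat \<Rightarrow> real^'n \<Rightarrow> ereal" where
  "optimal_cost A B1 B2 Q R1 R2 s xs =
     Inf {cost Q R1 R2 s x u1 u2 | x u1 u2.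
            x s = xs \<and> (\<forall>k\<ge>s. x (Suc k) = A *v x k + B1 *v u1 k + B2 *v u2 k)}"

end

theory Submission
  imports Defs "HOL-Computational_Algebra.Fundamental_Theorem_Algebra"
begin

text \<open>
  Write \<open>V(x) = x' P x\<close> and \<open>S = R + B' P B\<close>. The Riccati equation turns the cost of one step, with
  \<open>u = (u1, u2)\<close>, into
  \<open>x' Q x + u' R u = V(x(k)) - V(x(k+1)) + (u - K x)' S (u - K x)\<close>
  (\<open>riccati_completion_of_squares\<close>), and the two costs are compared by telescoping this identity from
  time \<open>N\<close> on.

  For the optimal cost, the last summand is nonnegative and \<open>V(x(k))\<close> tends to \<open>0\<close> along every trajectory of
  finite cost, by observability of \<open>(A, Q)\<close>; so every control costs at least \<open>V(x(N))\<close>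
  (\<open>optimal_cost_ge_value\<close>). For the decentralized controllers, \<open>V \<ge> 0\<close> alone shows that the cost is at most
  \<open>V(x(N))\<close> plus the tail from \<open>N\<close> on of the series of \<open>(u - K x)' S (u - K x)\<close>
  (\<open>suminf_telescope_upper\<close>). The excess is therefore at most this tail.

  The tail tends to \<open>0\<close> because \<open>u - K x\<close> is a linear function of the observer errors \<open>e = (x - xh1, x - xh2)\<close>,
  which obey \<open>e(k+1) = M e(k)\<close> with the block matrix \<open>M\<close> assumed stable. That such trajectories are
  absolutely summable (\<open>stable_trajectory_summable\<close>) is proved by splitting off, one at a time, the
  complex roots of a polynomial \<open>p\<close> with \<open>p(M) e(0) = 0\<close>.
\<close>

section \<open>Trajectories of stable matrices\<close>

text \<open>
  This is \<open>p(M) v\<close>. Recursing on the coefficients and acting on the vector, rather than forming the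
  matrix \<open>p(M)\<close>, gives the recursion \<open>p = a + X q \<Longrightarrow> p(M) v = a v + q(M) (M v)\<close>, from which everything
  below follows by induction on \<open>p\<close>.
\<close>

definition poly_act :: "'a::field^'n^'n \<Rightarrow> 'a poly \<Rightarrow> 'a^'n \<Rightarrow> 'a^'n" where
  "poly_act M p = fold_coeffs (\<lambda>a g v. a *s v + g (M *v v)) p (\<lambda>v. 0)"

lemma poly_act_0 [simp]: "poly_act M 0 v = 0"
  by (simp add: poly_act_def)

lemma poly_act_pCons [simp]: "poly_act M (pCons a p) v = a *s v + poly_act M p (M *v v)"
  by (cases "a = 0"; cases "p = 0") (simp_all add: poly_act_def)

lemma poly_act_add: "poly_act M (p + q) v = poly_act M p v + poly_act M q v"
  by (induction p q arbitrary: v rule: poly_induct2) (simp_all add: vec.scale_left_distrib)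

lemma poly_act_smult: "poly_act M (smult c p) v = c *s poly_act M p v"
  by (induction p arbitrary: v) (simp_all add: vec.scale_right_distrib)

lemma poly_act_sum: "poly_act M (\<Sum>i\<in>I. p i) v = (\<Sum>i\<in>I. poly_act M (p i) v)"
  by (induction I rule: infinite_finite_induct) (simp_all add: poly_act_add)

lemma poly_act_monom: "poly_act M (monom a i) v = a *s ((*v) M ^^ i) v"
proof (induction i arbitrary: v)
  case (Suc i)
  then show ?case by (simp add: monom_Suc funpow_swap1)
qed (simp add: monom_0)

lemma poly_act_vec_add: "poly_act M p (v + w) = poly_act M p v + poly_act M p w"
  by (induction p arbitrary: v w)
     (simp_all add: vec.scale_right_distrib matrix_vector_right_distrib)

lemma poly_act_vec_scale: "poly_act M p (c *s v) = c *s poly_act M p v"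
  by (induction p arbitrary: v)
     (simp_all add: vec.scale_right_distrib vec.scale_left_commute vec.scale mult.commute)

lemma poly_act_commute: "poly_act M p (M *v v) = M *v poly_act M p v"
  by (induction p arbitrary: v)
     (simp_all add: matrix_vector_right_distrib vec.scale)

lemma poly_act_linear_factor:
  "poly_act M ([:- z, 1:] * q) v = M *v poly_act M q v - z *s poly_act M q v"
proof -
  have "[:- z, 1:] * q = smult (- z) q + pCons 0 q" by simp
  then show ?thesis
    by (simp only: poly_act_add poly_act_smult poly_act_pCons poly_act_commute) simp
qed

lemma poly_act_linear_factor':
  "poly_act M ([:- z, 1:] * q) v = poly_act M q (M *v v - z *s v)"
proof -
  have "M *v v - z *s v = M *v v + (- z) *s v" by simp
  then show ?thesis
    by (simp only: poly_act_linear_factor poly_act_vec_add poly_act_vec_scale poly_act_commute) simp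
qed

text \<open>
  The \<open>n + 1\<close> vectors \<open>v, M v, \<dots>, M\<^sup>n v\<close> of an \<open>n\<close>-dimensional space are linearly dependent. When two of
  them coincide, as a set they may be independent, and \<open>X\<^sup>i - X\<^sup>j\<close> annihilates \<open>v\<close> instead.
\<close>

lemma annihilating_poly_exists:
  fixes M :: "'a::field^'n^'n"
  obtains p where "p \<noteq> 0" "poly_act M p v = 0"
proof -
  define f where "f = (\<lambda>i. ((*v) M ^^ i) v)"
  define I where "I = {..CARD('n)}"
  show thesis
  proof (cases "inj_on f I")
    case False
    then obtain i j where ij: "i \<noteq> j" "f i = f j" by (auto simp: inj_on_def)
    let ?p = "monom (1::'a) i + monom (-1) j"
    have "coeff ?p i \<noteq> 0" using ij by simp
    then have "?p \<noteq> 0" by (metis coeff_0)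
    moreover have "poly_act M ?p v = 0"
      using ij by (simp add: poly_act_add poly_act_monom f_def)
    ultimately show thesis by (rule that)
  next
    case True
    have "card (f ` I) = Suc (CARD('n))" using True by (simp add: card_image I_def)
    moreover have "vec.dim (f ` I) \<le> CARD('n)"
      by (rule dim_subset_UNIV_cart_gen)
    ultimately have "vec.dependent (f ` I)"
      by (intro vec.dependent_biggerset_general) simp
    then obtain u where u: "\<exists>w\<in>f ` I. u w \<noteq> 0" "(\<Sum>w\<in>f ` I. u w *s w) = 0"
      by (subst (asm) vec.dependent_finite) (auto simp: I_def)
    define p where "p = (\<Sum>i\<in>I. monom (u (f i)) i)"
    have co: "coeff p i = u (f i)" if "i \<in> I" for i
      using that by (simp add: p_def coeff_sum I_def)
    have "p \<noteq> 0" using u(1) co by fastforce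
    moreover have "poly_act M p v = (\<Sum>i\<in>I. u (f i) *s f i)"
      by (simp add: p_def poly_act_sum poly_act_monom f_def)
    then have "poly_act M p v = 0" using u(2) True by (simp add: sum.reindex)
    ultimately show thesis by (rule that)
  qed
qed

lemma norm_vector_scalar_mult: "norm (c *s v) = norm c * norm v" for c :: complex
  by (simp add: norm_vec_def norm_mult L2_set_right_distrib)

text \<open>
  Summing the inequality over \<open>k < n\<close> bounds \<open>(1 - r)\<close> times the partial sum of \<open>a\<close> by \<open>a 0 + \<Sum> b\<close>.
\<close>

lemma summable_of_perturbed_contraction:
  fixes a b :: "nat \<Rightarrow> real"
  assumes "\<And>k. a (Suc k) \<le> r * a k + b k" and "\<And>k. 0 \<le> a k" and "r < 1" and "0 \<le> r"
    and b: "summable b" "\<And>k. 0 \<le> b k"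
  shows "summable a"
proof -
  have "(\<Sum>k<n. a k) \<le> (a 0 + suminf b) / (1 - r)" for n
  proof -
    have "(\<Sum>k<n. a k) \<le> (\<Sum>k<Suc n. a k)" using assms(2) by simp
    also have "\<dots> = a 0 + (\<Sum>k<n. a (Suc k))" by (rule sum.lessThan_Suc_shift)
    also have "(\<Sum>k<n. a (Suc k)) \<le> (\<Sum>k<n. r * a k + b k)"
      by (intro sum_mono assms)
    also have "\<dots> = r * (\<Sum>k<n. a k) + (\<Sum>k<n. b k)"
      by (simp add: sum.distrib sum_distrib_left)
    also have "(\<Sum>k<n. b k) \<le> suminf b" by (intro sum_le_suminf b) auto
    finally have "(1 - r) * (\<Sum>k<n. a k) \<le> a 0 + suminf b" by (simp add: algebra_simps)
    then show ?thesis using \<open>r < 1\<close> by (simp add: pos_le_divide_eq mult.commute)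
  qed
  then show ?thesis
    by (intro bounded_imp_summable[where B = "(a 0 + suminf b) / (1 - r)"])
       (use assms(2) in \<open>auto simp: lessThan_Suc_atMost[symmetric] simp del: sum.lessThan_Suc\<close>)
qed

text \<open>
  Induction on the degree of an annihilating polynomial replaces the Jordan form. Split off a root:
  \<open>p = (X - z) q\<close>. If \<open>\<bar>z\<bar> < 1\<close>, the vector \<open>M v - z v\<close> is annihilated by \<open>q\<close>, so its orbit is summable, and
  the orbit of \<open>v\<close> is a contraction by \<open>z\<close> perturbed by that summable orbit. Otherwise \<open>z\<close> is not an
  eigenvalue, so \<open>(M - z) q(M) v = 0\<close> already forces \<open>q(M) v = 0\<close>.
\<close>

lemma summable_powers_of_annihilated:
  fixes M :: "complex^'n^'n"
  assumes stable: "\<And>l v. v \<noteq> 0 \<Longrightarrow> M *v v = l *s v \<Longrightarrow> cmod l < 1"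
    and "p \<noteq> 0" "poly_act M p v = 0"
  shows "summable (\<lambda>k. norm (((*v) M ^^ k) v))"
  using assms(2-)
proof (induction "degree p" arbitrary: p v rule: less_induct)
  case less
  show ?case
  proof (cases "degree p = 0")
    case True
    then obtain c where "p = [:c:]" by (metis degree_0_id)
    with less.prems have "v = 0" by (simp add: vec.scale_eq_0_iff)
    moreover have "((*v) M ^^ k) 0 = 0" for k by (induction k) simp_all
    ultimately show ?thesis by simp
  next
    case False
    then obtain z where "poly p z = 0"
      using fundamental_theorem_of_algebra[of p] by (auto simp: constant_degree)
    then obtain q where q: "p = [:- z, 1:] * q" by (auto simp: poly_eq_0_iff_dvd)
    with less.prems have "q \<noteq> 0" by auto
    then have deg: "degree q < degree p" unfolding q by (subst degree_mult_eq) auto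
    show ?thesis
    proof (cases "cmod z < 1")
      case True
      let ?w = "M *v v - z *s v"
      have w: "summable (\<lambda>k. norm (((*v) M ^^ k) ?w))"
        using less.hyps[OF deg \<open>q \<noteq> 0\<close>] less.prems(2) unfolding q
        by (simp only: poly_act_linear_factor')
      have step: "((*v) M ^^ Suc k) v = z *s ((*v) M ^^ k) v + ((*v) M ^^ k) ?w" for k
      proof (induction k)
        case (Suc k)
        have "((*v) M ^^ Suc (Suc k)) v = M *v ((*v) M ^^ Suc k) v" by simp
        also note Suc
        finally show ?case by (simp add: matrix_vector_right_distrib vec.scale)
      qed simp
      show ?thesis
      proof (rule summable_of_perturbed_contraction[OF _ _ True _ w])
        show "norm (((*v) M ^^ Suc k) v)
          \<le> cmod z * norm (((*v) M ^^ k) v) + norm (((*v) M ^^ k) ?w)" for k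
          unfolding step by (metis norm_triangle_ineq norm_vector_scalar_mult)
      qed auto
    next
      case False
      have "M *v poly_act M q v = z *s poly_act M q v"
        using less.prems(2) unfolding q by (simp only: poly_act_linear_factor) simp
      with stable False have "poly_act M q v = 0" by blast
      then show ?thesis using less.hyps[OF deg \<open>q \<noteq> 0\<close>] by blast
    qed
  qed
qed

text \<open>
  The real trajectory is an orbit of the complexified matrix, whose eigenvalues stability controls.
\<close>

lemma stable_trajectory_summable:
  fixes M :: "real^'n^'n"
  assumes "stable_matrix M" and step: "\<And>k. e (Suc k) = M *v e k"
  shows "summable (\<lambda>k. norm (e k))"
proof -
  define c where "c v = (\<chi> i. complex_of_real (v $ i))" for v :: "real^'n"
  have c_mult: "c (M *v v) = complex_matrix M *v c v" for v
    by (simp add: c_def complex_matrix_def matrix_vector_mult_def vec_eq_iff)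
  have c_norm: "norm (c v) = norm v" for v
    by (simp add: c_def norm_vec_def)
  have pow: "((*v) (complex_matrix M) ^^ k) (c (e 0)) = c (e k)" for k
    by (induction k) (simp_all add: step c_mult)
  obtain p where p: "p \<noteq> 0" "poly_act (complex_matrix M) p (c (e 0)) = 0"
    by (rule annihilating_poly_exists)
  have "summable (\<lambda>k. norm (((*v) (complex_matrix M) ^^ k) (c (e 0))))"
    by (rule summable_powers_of_annihilated[OF _ p])
       (use assms(1) in \<open>auto simp: stable_matrix_def complex_eigenvalue_def\<close>)
  then show ?thesis by (simp add: pow c_norm)
qed

section \<open>Stacked vectors and block matrices\<close>

definition vec_join :: "'a^'p \<Rightarrow> 'a^'q \<Rightarrow> 'a^('p::finite + 'q::finite)" where
  "vec_join v w = (\<chi> i. case i of Inl p \<Rightarrow> v $ p | Inr q \<Rightarrow> w $ q)"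

lemma sum_UNIV_plus:
  fixes f :: "'p::finite + 'q::finite \<Rightarrow> 'b::comm_monoid_add"
  shows "sum f UNIV = (\<Sum>p\<in>UNIV. f (Inl p)) + (\<Sum>q\<in>UNIV. f (Inr q))"
proof -
  have "sum f UNIV = sum f (UNIV <+> UNIV)" by (simp add: UNIV_Plus_UNIV)
  also have "\<dots> = (\<Sum>p\<in>UNIV. f (Inl p)) + (\<Sum>q\<in>UNIV. f (Inr q))"
    by (subst sum.Plus) simp_all
  finally show ?thesis .
qed

lemma vec_join_inner: "vec_join a b \<bullet> vec_join c d = a \<bullet> c + b \<bullet> d"
  for a c :: "real^'p" and b d :: "real^'q"
  by (simp add: inner_vec_def sum_UNIV_plus vec_join_def)

lemma vec_join_diff: "vec_join a b - vec_join c d = vec_join (a - c) (b - d)"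
  by (simp add: vec_join_def vec_eq_iff split_sum_all)

lemma vec_join_minus: "- vec_join a b = vec_join (- a) (- b)"
  by (simp add: vec_join_def vec_eq_iff split_sum_all)

lemma vec_join_eta: "vec_join (\<chi> p. v $ Inl p) (\<chi> q. v $ Inr q) = v"
  by (simp add: vec_join_def vec_eq_iff split_sum_all)

lemma vec_join_cases: obtains a b where "v = vec_join a b"
  using vec_join_eta[of v] by metis

lemma vec_join_eq_0_iff [simp]: "vec_join a b = 0 \<longleftrightarrow> a = 0 \<and> b = 0"
  by (simp add: vec_join_def vec_eq_iff split_sum_all)

lemma block_row_mult: "block_row M N *v vec_join a b = M *v a + N *v b"
  by (simp add: block_row_def vec_join_def matrix_vector_mult_def vec_eq_iff sum_UNIV_plus)

lemma block_col_mult: "block_col M N *v a = vec_join (M *v a) (N *v a)"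
  by (simp add: block_col_def vec_join_def matrix_vector_mult_def vec_eq_iff split_sum_all)

lemma block_mat_mult:
  "block_mat M11 M12 M21 M22 *v vec_join a b
     = vec_join (M11 *v a + M12 *v b) (M21 *v a + M22 *v b)"
  by (simp add: block_mat_def block_col_mult block_row_mult)

lemma block_col_upper_lower: "block_col (upper_rows M) (lower_rows M) = M"
  by (simp add: block_col_def upper_rows_def lower_rows_def vec_eq_iff split_sum_all)

lemma transpose_block_diag:
  "transpose (block_mat M 0 0 N) = block_mat (transpose M) 0 0 (transpose N)"
  by (simp add: block_mat_def block_col_def block_row_def transpose_def vec_eq_iff split_sum_all)

lemma sym_pos_def_block_diag:
  assumes "sym_pos_def R1" "sym_pos_def R2"
  shows "sym_pos_def (block_mat R1 0 0 R2)"
  unfolding sym_pos_def_def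
proof (intro conjI allI impI)
  show "transpose (block_mat R1 0 0 R2) = block_mat R1 0 0 R2"
    using assms by (simp add: transpose_block_diag sym_pos_def_def)
  fix v :: "real^('a + 'b)" assume "v \<noteq> 0"
  obtain a b where v: "v = vec_join a b" by (rule vec_join_cases)
  have pos: "0 \<le> a \<bullet> (R1 *v a)" "0 \<le> b \<bullet> (R2 *v b)"
    using assms by (cases "a = 0"; cases "b = 0"; force simp: sym_pos_def_def)+
  have "a \<noteq> 0 \<or> b \<noteq> 0" using \<open>v \<noteq> 0\<close> v by simp
  then have "0 < a \<bullet> (R1 *v a) \<or> 0 < b \<bullet> (R2 *v b)"
    using assms by (auto simp: sym_pos_def_def)
  with pos show "0 < v \<bullet> (block_mat R1 0 0 R2 *v v)"
    by (auto simp: v block_mat_mult vec_join_inner)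
qed

section \<open>Definite forms and completion of squares\<close>

lemma inner_transpose: "v \<bullet> (transpose M *v w) = (M *v v) \<bullet> w"
  for M :: "real^'n^'m"
  by (metis dot_lmul_matrix inner_commute transpose_matrix_vector)

lemma inner_vector_matrix: "v \<bullet> (w v* M) = (M *v v) \<bullet> w"
  for M :: "real^'n^'m"
  by (metis inner_transpose transpose_matrix_vector)

lemma sym_pos_def_imp_semidef: "sym_pos_def M \<Longrightarrow> sym_pos_semidef M"
  unfolding sym_pos_def_def sym_pos_semidef_def
  by (metis inner_zero_left less_eq_real_def)

lemma sym_pos_def_imp_invertible:
  assumes "sym_pos_def M"
  shows "invertible M"
proof -
  have "v = 0" if "M *v v = 0" for v
    using assms that by (metis inner_zero_right less_irrefl sym_pos_def_def)
  then show ?thesis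
    by (simp add: invertible_left_inverse matrix_left_invertible_ker)
qed

lemma matrix_inv_cancel:
  assumes "invertible M"
  shows "M ** matrix_inv M = mat 1" and "matrix_inv M ** M = mat 1"
  using someI_ex[OF assms[unfolded invertible_def]] by (auto simp: matrix_inv_def)

text \<open>
  The weight \<open>R + B' P B\<close> of the completed square is thus invertible, as the Riccati equation and the
  feedback gain presuppose.
\<close>

lemma sym_pos_def_add_congruence:
  fixes B :: "real^'m^'n"
  assumes "sym_pos_def R" "sym_pos_semidef P"
  shows "sym_pos_def (R + transpose B ** P ** B)"
  unfolding sym_pos_def_def
proof (intro conjI allI impI)
  have "transpose (transpose B ** P ** B) = transpose B ** P ** B"
    using assms(2) by (simp add: matrix_transpose_mul sym_pos_semidef_def matrix_mul_assoc)
  moreover have "transpose (X + Y) = transpose X + transpose Y" for X Y :: "real^'m^'m"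
    by (simp add: transpose_def vec_eq_iff)
  ultimately show "transpose (R + transpose B ** P ** B) = R + transpose B ** P ** B"
    using assms(1) by (simp add: sym_pos_def_def)
  fix v :: "real^'m" assume "v \<noteq> 0"
  have "v \<bullet> ((transpose B ** P ** B) *v v) = (B *v v) \<bullet> (P *v (B *v v))"
    by (simp add: matrix_vector_mul_assoc[symmetric] inner_vector_matrix)
  with \<open>v \<noteq> 0\<close> assms show "0 < v \<bullet> ((R + transpose B ** P ** B) *v v)"
    unfolding sym_pos_def_def sym_pos_semidef_def
    by (simp add: matrix_vector_mult_add_rdistrib inner_add_right add_pos_nonneg)
qed

text \<open>
  With \<open>V(x) = x' P x\<close> and \<open>S = R + B' P B\<close>, the stage cost is the decrease of \<open>V\<close> plus the penalty
  \<open>(u - K x)' S (u - K x)\<close> for deviating from the optimal feedback. Since \<open>S K = - B' P A\<close>, the cross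
  terms \<open>u' B' P A x\<close> in \<open>V(A x + B u)\<close> are \<open>- u' S K x\<close>, and the Riccati equation reads
  \<open>P = A' P A + Q - K' S K\<close>; comparing quadratic terms gives the identity.
\<close>

lemma riccati_completion_of_squares:
  fixes A Q P :: "real^'n^'n" and B :: "real^'m^'n" and R :: "real^'m^'m"
  assumes R: "sym_pos_def R" and P: "sym_pos_semidef P"
    and riccati: "riccati_solution A B Q R P"
  defines "K \<equiv> riccati_gain A B R P" and "S \<equiv> R + transpose B ** P ** B"
  shows "x \<bullet> (Q *v x) + u \<bullet> (R *v u)
       = x \<bullet> (P *v x) - (A *v x + B *v u) \<bullet> (P *v (A *v x + B *v u))
         + (u - K *v x) \<bullet> (S *v (u - K *v x))"
proof -
  have S: "sym_pos_def S" unfolding S_def using R P by (rule sym_pos_def_add_congruence)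
  have inv: "S ** matrix_inv S = mat 1"
    using sym_pos_def_imp_invertible[OF S] by (rule matrix_inv_cancel)
  have sym: "v \<bullet> (S *v w) = w \<bullet> (S *v v)" for v w
    using S by (metis inner_transpose sym_pos_def_def inner_commute)
  have symP: "v \<bullet> (P *v w) = w \<bullet> (P *v v)" for v w
    using P by (metis inner_transpose sym_pos_semidef_def inner_commute)
  let ?g = "transpose B *v (P *v (A *v x))"
  have Kx: "K *v x = - (matrix_inv S *v ?g)"
    unfolding K_def riccati_gain_def S_def
    by (simp add: matrix_vector_mul_assoc matrix_mul_assoc)
       (metis diff_0 matrix_vector_mult_0 matrix_vector_mult_diff_rdistrib)
  have SK: "S *v (K *v x) = - ?g"
    unfolding Kx using inv
    by (metis matrix_vector_mul_assoc matrix_vector_mul_lid diff_0 matrix_vector_mult_0_right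
        matrix_vector_mult_diff_distrib)
  have BPA: "(B *v v) \<bullet> (P *v (A *v x)) = - (v \<bullet> (S *v (K *v x)))" for v
    by (simp add: SK inner_vector_matrix)
  have Px: "x \<bullet> (P *v x) = (A *v x) \<bullet> (P *v (A *v x)) + x \<bullet> (Q *v x)
      - (K *v x) \<bullet> (S *v (K *v x))"
  proof -
    have "P *v x = transpose A *v (P *v (A *v x)) + Q *v x
        - transpose A *v (P *v (B *v (matrix_inv S *v ?g)))"
      using arg_cong[OF riccati[unfolded riccati_solution_def, folded S_def], of "\<lambda>M. M *v x"]
      by (simp add: matrix_vector_mult_add_rdistrib matrix_vector_mult_diff_rdistrib
          matrix_vector_mul_assoc[symmetric])
    also have "matrix_inv S *v ?g = - (K *v x)" by (simp add: Kx)
    also have "B *v (- (K *v x)) = - (B *v (K *v x))"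
      by (metis diff_0 matrix_vector_mult_0_right matrix_vector_mult_diff_distrib)
    finally have "x \<bullet> (P *v x) = (A *v x) \<bullet> (P *v (A *v x)) + x \<bullet> (Q *v x)
        - (A *v x) \<bullet> (P *v (- (B *v (K *v x))))"
      by (simp add: inner_add_right inner_diff_right inner_vector_matrix)
    also have "(A *v x) \<bullet> (P *v (- (B *v (K *v x)))) = - ((B *v (K *v x)) \<bullet> (P *v (A *v x)))"
      by (subst symP) simp
    also have "\<dots> = (K *v x) \<bullet> (S *v (K *v x))"
      by (simp add: BPA)
    finally show ?thesis .
  qed
  have Su: "u \<bullet> (S *v u) = u \<bullet> (R *v u) + (B *v u) \<bullet> (P *v (B *v u))"
    by (simp add: S_def matrix_vector_mult_add_rdistrib inner_add_right
        matrix_vector_mul_assoc[symmetric] inner_vector_matrix)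
  have "(A *v x + B *v u) \<bullet> (P *v (A *v x + B *v u))
      = (A *v x) \<bullet> (P *v (A *v x)) - 2 * (u \<bullet> (S *v (K *v x))) + (B *v u) \<bullet> (P *v (B *v u))"
    using BPA[of u] symP[of "A *v x" "B *v u"]
    by (simp add: matrix_vector_right_distrib inner_add_left inner_add_right)
  moreover have "(u - K *v x) \<bullet> (S *v (u - K *v x))
      = u \<bullet> (S *v u) - 2 * (u \<bullet> (S *v (K *v x))) + (K *v x) \<bullet> (S *v (K *v x))"
    using sym[of u "K *v x"]
    by (simp add: matrix_vector_mult_diff_distrib inner_diff_left inner_diff_right)
  ultimately show ?thesis using Px Su by simp
qed

section \<open>Vanishing of the state along finite-cost trajectories\<close>

text \<open>
  A positive semidefinite form controls the image of its matrix: if \<open>\<parallel>M\<parallel> \<le> C\<close>, then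
  \<open>\<parallel>M w\<parallel>\<^sup>2 \<le> C (w' M w)\<close>.
\<close>

lemma semidef_form_tendsto_0:
  fixes M :: "real^'n^'n"
  assumes M: "sym_pos_semidef M" and lim: "(\<lambda>k. v k \<bullet> (M *v v k)) \<longlonglongrightarrow> 0"
  shows "(\<lambda>k. M *v v k) \<longlonglongrightarrow> 0"
proof -
  obtain C where C: "C > 0" "\<And>v. norm (M *v v) \<le> norm v * C"
    using bounded_linear.pos_bounded[OF matrix_vector_mul_bounded_linear] by blast
  have bound: "(norm (M *v w))\<^sup>2 \<le> C * (w \<bullet> (M *v w))" for w
  proof -
    let ?m = "M *v w"
    have sym: "w \<bullet> (M *v ?m) = ?m \<bullet> ?m"
      using M by (metis inner_transpose sym_pos_semidef_def)
    have "?m \<bullet> (M *v ?m) \<le> norm ?m * norm (M *v ?m)" by (rule norm_cauchy_schwarz)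
    also have "\<dots> \<le> norm ?m * (norm ?m * C)" by (intro mult_left_mono C) simp
    finally have mm: "?m \<bullet> (M *v ?m) \<le> C * (?m \<bullet> ?m)"
      by (simp add: power2_norm_eq_inner[symmetric] power2_eq_square mult_ac)
    \<comment> \<open>The step \<open>1 / C\<close> minimises over \<open>t\<close> the bound \<open>w' M w - 2 t \<parallel>M w\<parallel>\<^sup>2 + t\<^sup>2 C \<parallel>M w\<parallel>\<^sup>2\<close> on the form at \<open>w - t M w\<close>.\<close>
    have "0 \<le> (w - (1 / C) *\<^sub>R ?m) \<bullet> (M *v (w - (1 / C) *\<^sub>R ?m))"
      using M unfolding sym_pos_semidef_def by blast
    also have "\<dots> = w \<bullet> ?m - 2 / C * (?m \<bullet> ?m) + (1 / C) * (1 / C) * (?m \<bullet> (M *v ?m))"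
      using sym by (simp add: matrix_vector_mult_diff_distrib matrix_vector_mult_scaleR
          inner_diff_left inner_diff_right diff_divide_distrib)
    also have "\<dots> \<le> w \<bullet> ?m - 2 / C * (?m \<bullet> ?m) + (1 / C) * (1 / C) * (C * (?m \<bullet> ?m))"
      using C(1) by (intro add_left_mono mult_left_mono mm) simp
    also have "\<dots> = w \<bullet> ?m - (?m \<bullet> ?m) / C"
      using C(1) by (simp add: field_simps)
    finally show ?thesis
      using C(1) by (simp add: power2_norm_eq_inner field_simps)
  qed
  have "(\<lambda>k. (norm (M *v v k))\<^sup>2) \<longlonglongrightarrow> 0"
    by (rule tendsto_sandwich[OF _ _ tendsto_const, where h = "\<lambda>k. C * (v k \<bullet> (M *v v k))"])
       (use bound tendsto_mult_left[OF lim, of C] in auto)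
  then have "(\<lambda>k. sqrt ((norm (M *v v k))\<^sup>2)) \<longlonglongrightarrow> sqrt 0" by (rule tendsto_real_sqrt)
  then show ?thesis by (simp add: tendsto_norm_zero_iff)
qed

lemma matrix_vector_tendsto_0: "v \<longlonglongrightarrow> 0 \<Longrightarrow> (\<lambda>k. M *v v k) \<longlonglongrightarrow> 0"
  for M :: "real^'n^'m"
  using bounded_linear.tendsto_zero[OF matrix_vector_mul_bounded_linear] .

lemma pos_def_form_tendsto_0:
  fixes M :: "real^'n^'n"
  assumes M: "sym_pos_def M" and lim: "(\<lambda>k. v k \<bullet> (M *v v k)) \<longlonglongrightarrow> 0"
  shows "v \<longlonglongrightarrow> 0"
proof -
  have "(\<lambda>k. matrix_inv M *v (M *v v k)) \<longlonglongrightarrow> 0"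
    by (intro matrix_vector_tendsto_0 semidef_form_tendsto_0 lim sym_pos_def_imp_semidef M)
  then show ?thesis
    using matrix_inv_cancel(2)[OF sym_pos_def_imp_invertible[OF M]]
    by (simp add: matrix_vector_mul_assoc)
qed

lemma linear_output_map:
  fixes A :: "real^'n^'n" and C :: "real^'n^'s"
  shows "linear (\<lambda>w. C *v ((*v) A ^^ j) w)"
proof -
  have "linear ((*v) A ^^ j)"
  proof (induction j)
    case 0
    show ?case unfolding funpow.simps by (rule linear_id)
  next
    case (Suc j)
    show ?case
      unfolding funpow.simps by (rule linear_compose[OF Suc matrix_vector_mul_linear])
  qed
  from linear_compose[OF this matrix_vector_mul_linear[of C]] show ?thesis
    by (simp add: o_def)
qed

text \<open>
  The observability Gramian \<open>G = \<Sum>j\<le>N. (C A\<^sup>j)' C A\<^sup>j\<close> is injective, because \<open>G v = 0\<close> gives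
  \<open>\<Sum>j\<le>N. \<parallel>C A\<^sup>j v\<parallel>\<^sup>2 = v' G v = 0\<close>. A linear left inverse of \<open>G\<close> therefore recovers the states
  continuously from \<open>N + 1\<close> outputs.
\<close>

lemma observable_outputs_tendsto_0:
  fixes A :: "real^'n^'n" and C :: "real^'n^'s" and x :: "nat \<Rightarrow> real^'n"
  assumes "observable A C" and outs: "\<And>j. (\<lambda>k. C *v ((*v) A ^^ j) (x k)) \<longlonglongrightarrow> 0"
  shows "x \<longlonglongrightarrow> 0"
proof -
  obtain N where N: "\<And>a b. (\<forall>k\<le>N. C *v ((*v) A ^^ k) a = C *v ((*v) A ^^ k) b) \<Longrightarrow> a = b"
    using assms(1) unfolding observable_def by blast
  define f where "f j = (\<lambda>w. C *v ((*v) A ^^ j) w)" for j :: nat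
  have f: "linear (f j)" for j
    unfolding f_def by (rule linear_output_map)
  define G where "G v = (\<Sum>j\<le>N. adjoint (f j) (f j v))" for v
  have linG: "linear G"
    unfolding G_def
    by (intro linear_compose_sum ballI linear_compose[OF f adjoint_linear[OF f], unfolded o_def])
  have "v = 0" if "G v = 0" for v
  proof -
    have "0 = v \<bullet> G v" using that by simp
    also have "\<dots> = (\<Sum>j\<le>N. f j v \<bullet> f j v)"
      by (simp add: G_def inner_sum_right adjoint_works[OF f])
    finally have "\<forall>j\<in>{..N}. f j v \<bullet> f j v = 0"
      by (subst (asm) eq_commute, subst (asm) sum_nonneg_eq_0_iff) auto
    then have "f j v = f j 0" if "j \<le> N" for j using that linear_0[OF f] by simp
    then show "v = 0" using N[of v 0] by (simp add: f_def)
  qed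
  then have "inj G" using linG by (simp add: linear_injective_0)
  then obtain h where h: "linear h" "h \<circ> G = id"
    using linear_injective_left_inverse[OF linG] by blast
  have "h (G v) = v" for v using fun_cong[OF h(2), of v] by simp
  moreover have "(\<lambda>k. G (x k)) \<longlonglongrightarrow> 0"
    unfolding G_def
  proof (rule tendsto_null_sum)
    fix j
    have "bounded_linear (adjoint (f j))"
      using adjoint_linear[OF f] by (simp add: linear_conv_bounded_linear)
    moreover have "(\<lambda>k. f j (x k)) \<longlonglongrightarrow> 0" using outs by (simp add: f_def)
    ultimately show "(\<lambda>k. adjoint (f j) (f j (x k))) \<longlonglongrightarrow> 0"
      by (rule bounded_linear.tendsto_zero)
  qed
  then have "(\<lambda>k. h (G (x k))) \<longlonglongrightarrow> 0"
    using h(1) by (intro bounded_linear.tendsto_zero[of h]) (simp_all add: linear_conv_bounded_linear)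
  ultimately show ?thesis by simp
qed

text \<open>
  Over any fixed number \<open>j\<close> of steps, a vanishing input moves \<open>x(k + j)\<close> away from \<open>A\<^sup>j x(k)\<close> only by a
  vanishing amount, so vanishing actual outputs imply vanishing outputs of the autonomous system
  started at \<open>x(k)\<close>.
\<close>

lemma observable_state_tendsto_0:
  fixes A :: "real^'n^'n" and C :: "real^'n^'s" and x r :: "nat \<Rightarrow> real^'n"
  assumes obs: "observable A C" and step: "\<And>k. x (Suc k) = A *v x k + r k"
    and r: "r \<longlonglongrightarrow> 0" and out: "(\<lambda>k. C *v x k) \<longlonglongrightarrow> 0"
  shows "x \<longlonglongrightarrow> 0"
proof -
  have diff: "(\<lambda>k. x (k + j) - ((*v) A ^^ j) (x k)) \<longlonglongrightarrow> 0" for j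
  proof (induction j)
    case (Suc j)
    have "x (k + Suc j) - ((*v) A ^^ Suc j) (x k)
        = A *v (x (k + j) - ((*v) A ^^ j) (x k)) + r (k + j)" for k
      by (simp add: step matrix_vector_mult_diff_distrib)
    moreover have "(\<lambda>k. A *v (x (k + j) - ((*v) A ^^ j) (x k)) + r (k + j)) \<longlonglongrightarrow> 0 + 0"
      by (intro tendsto_add matrix_vector_tendsto_0 Suc LIMSEQ_ignore_initial_segment r)
    ultimately show ?case by simp
  qed simp
  have "(\<lambda>k. C *v ((*v) A ^^ j) (x k)) \<longlonglongrightarrow> 0" for j
  proof -
    have "(\<lambda>k. C *v x (k + j) - C *v (x (k + j) - ((*v) A ^^ j) (x k))) \<longlonglongrightarrow> 0 - 0"
      by (intro tendsto_diff matrix_vector_tendsto_0 diff LIMSEQ_ignore_initial_segment[OF out])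
    then show ?thesis by (simp add: matrix_vector_mult_diff_distrib)
  qed
  with obs show ?thesis by (rule observable_outputs_tendsto_0)
qed

section \<open>Telescoping costs\<close>

text \<open>
  The terminal term \<open>- V n\<close> of the telescoping sum is dropped, which \<open>V \<ge> 0\<close> permits.
\<close>

lemma suminf_telescope_upper:
  fixes l V w :: "nat \<Rightarrow> real"
  assumes l: "\<And>k. l k = V k - V (Suc k) + w k"
    and nonneg: "\<And>k. 0 \<le> l k" "\<And>k. 0 \<le> V k" "\<And>k. 0 \<le> w k" and w: "summable w"
  shows "(\<Sum>k. ereal (l k)) \<le> ereal (V 0 + suminf w)"
proof (rule suminf_bound)
  show "\<forall>n. (\<Sum>k<n. ereal (l k)) \<le> ereal (V 0 + suminf w)"
  proof
    fix n
    have "(\<Sum>k<n. l k) = V 0 - V n + (\<Sum>k<n. w k)"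
      by (simp add: l sum.distrib sum_lessThan_telescope')
    also have "\<dots> \<le> V 0 + suminf w"
      using nonneg(2)[of n] sum_le_suminf[OF w, of "{..<n}"] nonneg(3) by simp
    finally show "(\<Sum>k<n. ereal (l k)) \<le> ereal (V 0 + suminf w)" by simp
  qed
qed (use nonneg(1) in simp)

text \<open>
  Here the terminal term has the wrong sign and has to vanish in the limit, but only for a convergent
  series: a divergent one has the value \<open>\<infinity>\<close>.
\<close>

lemma suminf_telescope_lower:
  fixes l V :: "nat \<Rightarrow> real"
  assumes l: "\<And>k. V k - V (Suc k) \<le> l k" and nonneg: "\<And>k. 0 \<le> l k"
    and lim: "summable l \<Longrightarrow> V \<longlonglongrightarrow> 0"
  shows "ereal (V 0) \<le> (\<Sum>k. ereal (l k))"
proof (cases "(\<Sum>k. ereal (l k)) = \<infinity>")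
  case False
  then have l_sum: "summable l" using summable_ereal[of l] nonneg by simp
  have "(\<lambda>n. V 0 - V n) \<longlonglongrightarrow> V 0 - 0"
    by (intro tendsto_diff tendsto_const lim l_sum)
  moreover have "V 0 - V n \<le> suminf l" for n
  proof -
    have "V 0 - V n = (\<Sum>k<n. V k - V (Suc k))" by (rule sum_lessThan_telescope'[symmetric])
    also have "\<dots> \<le> (\<Sum>k<n. l k)" by (intro sum_mono l)
    also have "\<dots> \<le> suminf l" by (intro sum_le_suminf l_sum nonneg) auto
    finally show ?thesis .
  qed
  ultimately have "V 0 - 0 \<le> suminf l" by (intro LIMSEQ_le_const2) auto
  moreover have "(\<Sum>k. ereal (l k)) = ereal (suminf l)"
    using l_sum by (rule suminf_ereal')
  ultimately show ?thesis by simp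
qed simp

lemma summable_form_of_summable_norm:
  fixes M :: "real^'n^'n" and e :: "nat \<Rightarrow> real^'n"
  assumes "summable (\<lambda>k. norm (e k))"
  shows "summable (\<lambda>k. e k \<bullet> (M *v e k))"
proof -
  obtain C where C: "C > 0" "\<And>v. norm (M *v v) \<le> norm v * C"
    using bounded_linear.pos_bounded[OF matrix_vector_mul_bounded_linear] by blast
  have "(\<lambda>k. norm (e k)) \<longlonglongrightarrow> 0" using assms by (rule summable_LIMSEQ_zero)
  then have ev: "\<forall>\<^sub>F k in sequentially. norm (e k) < 1" by (rule order_tendstoD) simp
  show ?thesis
  proof (rule summable_comparison_test_ev)
    show "summable (\<lambda>k. C * norm (e k))" using assms by (rule summable_mult)
    show "\<forall>\<^sub>F k in sequentially. norm (e k \<bullet> (M *v e k)) \<le> C * norm (e k)"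
      using ev
    proof eventually_elim
      case (elim k)
      have "norm (e k \<bullet> (M *v e k)) \<le> norm (e k) * norm (M *v e k)"
        by (simp add: Cauchy_Schwarz_ineq2)
      also have "\<dots> \<le> 1 * (norm (e k) * C)" using elim C by (intro mult_mono) auto
      finally show ?case by (simp add: mult.commute)
    qed
  qed
qed

text \<open>
  By completing the square, any admissible cost is at least the total decrease of \<open>V(x) = x' P x\<close>. If the
  cost is finite, the stage costs tend to \<open>0\<close>; hence so do \<open>Q x\<close> and, \<open>R\<close> being definite, \<open>u\<close>.
  Observability then drives the state to \<open>0\<close>, so the total decrease is all of \<open>V(x(s))\<close>.
\<close>

lemma optimal_cost_ge_value:
  fixes A Q P :: "real^'n^'n" and B1 :: "real^'m1^'n" and B2 :: "real^'m2^'n"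
    and R1 :: "real^'m1^'m1" and R2 :: "real^'m2^'m2"
  assumes Q: "sym_pos_semidef Q" and R1: "sym_pos_def R1" and R2: "sym_pos_def R2"
    and P: "sym_pos_semidef P"
    and riccati: "riccati_solution A (block_row B1 B2) Q (block_mat R1 0 0 R2) P"
    and obs: "observable A Q"
  shows "ereal (xs \<bullet> (P *v xs)) \<le> optimal_cost A B1 B2 Q R1 R2 s xs"
  unfolding optimal_cost_def
proof (rule Inf_greatest, clarify)
  fix x :: "nat \<Rightarrow> real^'n" and u1 :: "nat \<Rightarrow> real^'m1" and u2 :: "nat \<Rightarrow> real^'m2"
  assume step: "\<forall>k\<ge>s. x (Suc k) = A *v x k + B1 *v u1 k + B2 *v u2 k"
  let ?R = "block_mat R1 0 0 R2" and ?B = "block_row B1 B2"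
  let ?S = "?R + transpose ?B ** P ** ?B" and ?K = "riccati_gain A ?B ?R P"
  define X where "X j = x (s + j)" for j
  define U where "U j = vec_join (u1 (s + j)) (u2 (s + j))" for j
  define l where "l j = X j \<bullet> (Q *v X j) + U j \<bullet> (?R *v U j)" for j
  have R: "sym_pos_def ?R" using R1 R2 by (rule sym_pos_def_block_diag)
  have S: "sym_pos_semidef ?S"
    by (intro sym_pos_def_imp_semidef sym_pos_def_add_congruence R P)
  have X_step: "X (Suc j) = A *v X j + ?B *v U j" for j
    using step by (simp add: X_def U_def block_row_mult add.assoc)
  have nonneg: "0 \<le> X j \<bullet> (Q *v X j)" "0 \<le> U j \<bullet> (?R *v U j)" for j
    using Q sym_pos_def_imp_semidef[OF R] by (auto simp: sym_pos_semidef_def)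
  have "ereal (X 0 \<bullet> (P *v X 0)) \<le> (\<Sum>j. ereal (l j))"
  proof (rule suminf_telescope_lower[where V = "\<lambda>j. X j \<bullet> (P *v X j)"])
    show "X j \<bullet> (P *v X j) - X (Suc j) \<bullet> (P *v X (Suc j)) \<le> l j" for j
      using riccati_completion_of_squares[OF R P riccati, of "X j" "U j"] S
      by (simp add: l_def X_step sym_pos_semidef_def)
    show "0 \<le> l j" for j using nonneg by (simp add: l_def)
    assume "summable l"
    then have l0: "l \<longlonglongrightarrow> 0" by (rule summable_LIMSEQ_zero)
    have "(\<lambda>j. X j \<bullet> (Q *v X j)) \<longlonglongrightarrow> 0" "(\<lambda>j. U j \<bullet> (?R *v U j)) \<longlonglongrightarrow> 0"
      by (rule tendsto_sandwich[OF _ _ tendsto_const l0]; use nonneg in \<open>simp add: l_def\<close>)+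
    then have QX: "(\<lambda>j. Q *v X j) \<longlonglongrightarrow> 0" and "U \<longlonglongrightarrow> 0"
      using semidef_form_tendsto_0[OF Q] pos_def_form_tendsto_0[OF R] by auto
    have "(\<lambda>j. ?B *v U j) \<longlonglongrightarrow> 0"
      using \<open>U \<longlonglongrightarrow> 0\<close> by (rule matrix_vector_tendsto_0)
    with obs X_step have "X \<longlonglongrightarrow> 0"
      using QX by (rule observable_state_tendsto_0)
    then show "(\<lambda>j. X j \<bullet> (P *v X j)) \<longlonglongrightarrow> 0"
      using tendsto_inner[OF \<open>X \<longlonglongrightarrow> 0\<close> matrix_vector_tendsto_0[of X P]] by simp
  qed
  also have "(\<Sum>j. ereal (l j)) = cost Q R1 R2 s x u1 u2"
    by (simp add: cost_def l_def X_def U_def block_mat_mult vec_join_inner add.assoc)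
  finally show "ereal (x s \<bullet> (P *v x s)) \<le> cost Q R1 R2 s x u1 u2"
    by (simp add: X_def)
qed

section \<open>Asymptotic optimality\<close>

theorem mainTheorem5:
  fixes A Q P :: "real^'n^'n"
    and B1 :: "real^'m1^'n" and B2 :: "real^'m2^'n"
    and H1 :: "real^'n^'s1" and H2 :: "real^'n^'s2"
    and R1 :: "real^'m1^'m1" and R2 :: "real^'m2^'m2"
    and L1 :: "real^'s1^'n" and L2 :: "real^'s2^'n"
    and B :: "real^('m1::finite + 'm2::finite)^'n" and R :: "real^('m1 + 'm2)^('m1 + 'm2)"
    and K :: "real^'n^('m1 + 'm2)" and K1 :: "real^'n^'m1" and K2 :: "real^'n^'m2"
    and x xh1 xh2 :: "nat \<Rightarrow> real^'n"
    and u1 :: "nat \<Rightarrow> real^'m1" and u2 :: "nat \<Rightarrow> real^'m2"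
    and y1 :: "nat \<Rightarrow> real^'s1" and y2 :: "nat \<Rightarrow> real^'s2"
  assumes B_eq: "B = block_row B1 B2"
    and R_eq: "R = block_mat R1 0 0 R2"
    and Q: "sym_pos_semidef Q"
    and R1: "sym_pos_def R1"
    and R2: "sym_pos_def R2"
    and P_psd: "sym_pos_semidef P"
    and P_riccati: "riccati_solution A B Q R P"
    and K_eq: "K = riccati_gain A B R P"
    and K1_eq: "K1 = upper_rows K"
    and K2_eq: "K2 = lower_rows K"
    and stabilizable: "stabilizable A B"
    and observable: "observable A Q"
    and stable: "stable_matrix (block_mat (A + B2 ** K2 - L1 ** H1) (- (B2 ** K2))
                                   (- (B1 ** K1)) (A + B1 ** K1 - L2 ** H2))"
    and state: "\<And>k. x (Suc k) = A *v x k + B1 *v u1 k + B2 *v u2 k"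
    and output1: "\<And>k. y1 k = H1 *v x k"
    and output2: "\<And>k. y2 k = H2 *v x k"
    and control1: "\<And>k. u1 k = K1 *v xh1 k"
    and control2: "\<And>k. u2 k = K2 *v xh2 k"
    and observer1: "\<And>k. xh1 (Suc k) =
          A *v xh1 k + B1 *v u1 k + B2 *v (K2 *v xh1 k) + L1 *v (y1 k - H1 *v xh1 k)"
    and observer2: "\<And>k. xh2 (Suc k) =
          A *v xh2 k + B1 *v (K1 *v xh2 k) + B2 *v u2 k + L2 *v (y2 k - H2 *v xh2 k)"
  shows "\<forall>\<epsilon>::real. \<epsilon> > 0 \<longrightarrow>
    (\<exists>N::nat. cost Q R1 R2 N x u1 u2 - optimal_cost A B1 B2 Q R1 R2 N (x N) < ereal \<epsilon>)"
proof (intro allI impI)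
  fix \<epsilon> :: real assume "\<epsilon> > 0"
  have R: "sym_pos_def R" unfolding R_eq using R1 R2 by (rule sym_pos_def_block_diag)
  define S where "S = R + transpose B ** P ** B"
  have S_psd: "sym_pos_semidef S"
    unfolding S_def by (intro sym_pos_def_imp_semidef sym_pos_def_add_congruence R P_psd)
  have Q_nonneg: "0 \<le> v \<bullet> (Q *v v)" and P_nonneg: "0 \<le> v \<bullet> (P *v v)" for v
    using Q P_psd by (auto simp: sym_pos_semidef_def)
  have R_nonneg: "0 \<le> v \<bullet> (R *v v)" and S_nonneg: "0 \<le> v \<bullet> (S *v v)" for v
    using sym_pos_def_imp_semidef[OF R] S_psd by (auto simp: sym_pos_semidef_def)
  have K_mult: "K *v v = vec_join (K1 *v v) (K2 *v v)" for v
    using block_col_mult[of K1 K2 v] by (simp add: K1_eq K2_eq block_col_upper_lower)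

  \<comment> \<open>Substituting \<open>xh2 - xh1 = e1 - e2\<close> in the observers makes the errors autonomous, with exactly the
     matrix assumed stable.\<close>
  define e where "e k = vec_join (x k - xh1 k) (x k - xh2 k)" for k
  have e_step: "e (Suc k) = block_mat (A + B2 ** K2 - L1 ** H1) (- (B2 ** K2))
      (- (B1 ** K1)) (A + B1 ** K1 - L2 ** H2) *v e k" for k
  proof -
    have neg: "(- M) *v v = - (M *v v)" for M :: "real^'n^'n" and v
      by (metis diff_0 matrix_vector_mult_0 matrix_vector_mult_diff_rdistrib)
    show ?thesis
      unfolding e_def block_mat_mult state observer1 observer2 output1 output2 control1 control2
      by (simp add: neg matrix_vector_mult_add_rdistrib matrix_vector_mult_diff_rdistrib
          matrix_vector_mult_diff_distrib matrix_vector_mul_assoc[symmetric] algebra_simps)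
  qed
  have e_summable: "summable (\<lambda>k. norm (e k))"
    using stable e_step by (rule stable_trajectory_summable)

  define u where "u k = vec_join (u1 k) (u2 k)" for k
  define d where "d k = u k - K *v x k" for k
  have d_eq: "d k = block_mat K1 0 0 K2 *v (- e k)" for k
  proof -
    have "- e k = vec_join (xh1 k - x k) (xh2 k - x k)"
      by (simp add: e_def vec_join_minus)
    then show ?thesis
      by (simp add: d_def u_def K_mult control1 control2 vec_join_diff block_mat_mult
          matrix_vector_mult_diff_distrib)
  qed
  define w where "w k = d k \<bullet> (S *v d k)" for k
  have w_eq: "w k = (- e k) \<bullet>
      ((transpose (block_mat K1 0 0 K2) ** S ** block_mat K1 0 0 K2) *v (- e k))" for k
    by (simp only: w_def d_eq matrix_vector_mul_assoc[symmetric] inner_transpose)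
  have w_summable: "summable w"
    unfolding w_eq[abs_def] by (rule summable_form_of_summable_norm) (simp add: e_summable)
  obtain N where N: "\<And>n. n \<ge> N \<Longrightarrow> norm (\<Sum>i. w (i + n)) < \<epsilon>"
    using suminf_exist_split[OF \<open>\<epsilon> > 0\<close> w_summable] by blast
  define tail where "tail = (\<Sum>j. w (j + N))"
  have "tail < \<epsilon>" using N[of N] by (simp add: tail_def)

  define V where "V v = v \<bullet> (P *v v)" for v
  let ?l = "\<lambda>k. x k \<bullet> (Q *v x k) + u k \<bullet> (R *v u k)"
  have x_step: "x (Suc k) = A *v x k + B *v u k" for k
    by (simp add: state u_def B_eq block_row_mult add.assoc)
  have "cost Q R1 R2 N x u1 u2 = (\<Sum>j. ereal (?l (N + j)))"
    by (simp add: cost_def u_def R_eq block_mat_mult vec_join_inner add.assoc)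
  also have "\<dots> \<le> ereal (V (x (N + 0)) + (\<Sum>j. w (N + j)))"
  proof (rule suminf_telescope_upper[where V = "\<lambda>j. V (x (N + j))"])
    show "?l (N + j) = V (x (N + j)) - V (x (N + Suc j)) + w (N + j)" for j
      using riccati_completion_of_squares[OF R P_psd P_riccati, of "x (N + j)" "u (N + j)"]
      by (simp add: V_def w_def d_def S_def K_eq x_step)
    show "summable (\<lambda>j. w (N + j))"
      using summable_ignore_initial_segment[OF w_summable, of N] by (simp add: add.commute)
  qed (use Q_nonneg R_nonneg S_nonneg P_nonneg in \<open>auto simp: V_def w_def\<close>)
  finally have "cost Q R1 R2 N x u1 u2 \<le> ereal (V (x N) + tail)"
    by (simp add: tail_def add.commute)
  moreover have "ereal (V (x N)) \<le> optimal_cost A B1 B2 Q R1 R2 N (x N)"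
    unfolding V_def
    by (rule optimal_cost_ge_value[OF Q R1 R2 P_psd P_riccati[unfolded B_eq R_eq] observable])
  ultimately have "cost Q R1 R2 N x u1 u2 - optimal_cost A B1 B2 Q R1 R2 N (x N)
      \<le> ereal (V (x N) + tail) - ereal (V (x N))"
    by (rule ereal_minus_mono)
  also have "\<dots> < ereal \<epsilon>" using \<open>tail < \<epsilon>\<close> by simp
  finally show "\<exists>N. cost Q R1 R2 N x u1 u2 - optimal_cost A B1 B2 Q R1 R2 N (x N) < ereal \<epsilon>"
    by blast
qed

end
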